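(* Let $k$ be a field, $\mathfrak{L}$ a Leibniz algebra over $k$, $E$ a $k$-vector space and $\pi : E \to \mathfrak{L}$ a surjective linear map with $\mathfrak{g} = \mathrm{Ker}(\pi)$, and let $i : \mathfrak{g} \to E$ be the inclusion. Let $[-,-]_E$ be a Leibniz algebra structure on $E$ such that $\pi : (E, [-,-]_E) \to \mathfrak{L}$ is a morphism of Leibniz algebras. Then there exist a crossed system $\Lambda(\mathfrak{L},\mathfrak{g}) = (\triangleleft, \triangleright, f, [-,-]_{\mathfrak{g}})$ of $\mathfrak{L}$ by $\mathfrak{g}$ and an isomorphism of Leibniz algebras $\varphi : \mathfrak{g} \# \mathfrak{L} \to (E, [-,-]_E)$ that stabilizes $\mathfrak{g}$ and co-stabilizes $\mathfrak{L}$, i.e. $\varphi \circ i_{\mathfrak{g}} = i$ and $\pi \circ \varphi = \pi_{\mathfrak{L}}$. In particular, any Leibniz algebra extension of $\mathfrak{L}$ by $\mathfrak{g}$ is cohomologous to a crossed product extension $0 \to \mathfrak{g} \xrightarrow{i_{\mathfrak{g}}} \mathfrak{g} \# \mathfrak{L} \xrightarrow{\pi_{\mathfrak{L}}} \mathfrak{L} \to 0$.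
   Context: All vector spaces, Leibniz algebras, linear and bilinear maps are over an arbitrary field $k$. A Leibniz algebra is a vector space $\mathfrak{L}$ with a bilinear map $[-,-]$ satisfying $[x,[y,z]] = [[x,y],z] - [[x,z],y]$ for all $x,y,z$. Crossed systems and crossed products: for a Leibniz algebra $\mathfrak{L}$ and a vector space $\mathfrak{g}$, a pre-crossed datum of $\mathfrak{L}$ by $\mathfrak{g}$ is a quadruple $(\triangleleft, \triangleright, f, [-,-]_{\mathfrak{g}})$ of bilinear maps $\triangleleft : \mathfrak{g} \times \mathfrak{L} \to \mathfrak{g}$, $\triangleright : \mathfrak{L} \times \mathfrak{g} \to \mathfrak{g}$, $f : \mathfrak{L} \times \mathfrak{L} \to \mathfrak{g}$, $[-,-]_{\mathfrak{g}} : \mathfrak{g} \times \mathfrak{g} \to \mathfrak{g}$. Denote by $\mathfrak{g} \# \mathfrak{L}$ the vector space $\mathfrak{g} \times \mathfrak{L}$ with the bracket $\{(g,x),(h,y)\} := ([g,h]_{\mathfrak{g}} + x \triangleright h + g \triangleleft y + f(x,y), [x,y])$. The datum is called a crossed system, and $\mathfrak{g} \# \mathfrak{L}$ the associated crossed product, if $\mathfrak{g}\#\mathfrak{L}$ with this bracket is a Leibniz algebra. The canonical maps are $i_{\mathfrak{g}} : \mathfrak{g} \to \mathfrak{g}\#\mathfrak{L}$, $i_{\mathfrak{g}}(g) = (g,0)$, and $\pi_{\mathfrak{L}} : \mathfrak{g}\#\mathfrak{L} \to \mathfrak{L}$, $\pi_{\mathfrak{L}}(g,x) = x$. An extension of a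 Leibniz algebra $\mathfrak{L}$ by a Leibniz algebra $\mathfrak{g}$ is an exact sequence of Leibniz algebras $0 \to \mathfrak{g} \to \mathfrak{E} \to \mathfrak{L} \to 0$. Two extensions are cohomologous if there is an isomorphism of Leibniz algebras between the middle terms that is compatible with the maps from $\mathfrak{g}$ (stabilizes $\mathfrak{g}$) and with the maps to $\mathfrak{L}$ (co-stabilizes $\mathfrak{L}$). *)

theory Defs
  imports "HOL-Analysis.Product_Vector"
begin

text \<open>
  A vector space over a field \<open>'k\<close> is given by a carrier set and a scalar multiplication on an
  ambient type; the carrier is a subspace of that type. With carrier \<open>UNIV\<close> this covers every
  vector space on a type, and carriers are needed so that kernels are again objects of the same
  kind. Maps and brackets are HOL functions on the ambient types, of which only the values on the
  carriers matter.
\<close>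

record ('k, 'v) vect =
  carr :: "'v set"
  smult :: "'k \<Rightarrow> 'v \<Rightarrow> 'v"

record ('k, 'v) alg = "('k, 'v) vect" +
  brack :: "'v \<Rightarrow> 'v \<Rightarrow> 'v"

definition vector_space_on :: "('k::field, 'v::ab_group_add, 'm) vect_scheme \<Rightarrow> bool" where
  "vector_space_on V \<longleftrightarrow> vector_space (smult V) \<and> module.subspace (smult V) (carr V)"

definition linear_map ::
  "('k, 'v::ab_group_add, 'm) vect_scheme \<Rightarrow> ('k, 'w::ab_group_add, 'n) vect_scheme
    \<Rightarrow> ('v \<Rightarrow> 'w) \<Rightarrow> bool" where
  "linear_map V W h \<longleftrightarrow>
     (\<forall>x\<in>carr V. h x \<in> carr W) \<and>
     (\<forall>x\<in>carr V. \<forall>y\<in>carr V. h (x + y) = h x + h y) \<and>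
     (\<forall>c. \<forall>x\<in>carr V. h (smult V c x) = smult W c (h x))"

definition bilinear_map ::
  "('k, 'u::ab_group_add, 'l) vect_scheme \<Rightarrow> ('k, 'v::ab_group_add, 'm) vect_scheme
    \<Rightarrow> ('k, 'w::ab_group_add, 'n) vect_scheme \<Rightarrow> ('u \<Rightarrow> 'v \<Rightarrow> 'w) \<Rightarrow> bool" where
  "bilinear_map U V W b \<longleftrightarrow>
     (\<forall>u\<in>carr U. linear_map V W (\<lambda>v. b u v)) \<and>
     (\<forall>v\<in>carr V. linear_map U W (\<lambda>u. b u v))"

definition kernel_space ::
  "('k, 'v, 'm) vect_scheme \<Rightarrow> ('v \<Rightarrow> 'w::zero) \<Rightarrow> ('k, 'v) vect" where
  "kernel_space V h = \<lparr>carr = {x \<in> carr V. h x = 0}, smult = smult V\<rparr>"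

definition prod_space ::
  "('k::field, 'v::ab_group_add, 'm) vect_scheme \<Rightarrow> ('k, 'w::ab_group_add, 'n) vect_scheme
    \<Rightarrow> ('k, 'v \<times> 'w) vect" where
  "prod_space V W =
     \<lparr>carr = carr V \<times> carr W, smult = module_prod.scale (smult V) (smult W)\<rparr>"

definition with_bracket ::
  "('k, 'v, 'm) vect_scheme \<Rightarrow> ('v \<Rightarrow> 'v \<Rightarrow> 'v) \<Rightarrow> ('k, 'v) alg" where
  "with_bracket V b = \<lparr>carr = carr V, smult = smult V, brack = b\<rparr>"

definition leibniz_algebra :: "('k::field, 'v::ab_group_add) alg \<Rightarrow> bool" where
  "leibniz_algebra L \<longleftrightarrow>
     vector_space_on L \<and>
     bilinear_map L L L (brack L) \<and>
     (\<forall>x\<in>carr L. \<forall>y\<in>carr L. \<forall>z\<in>carr L.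
        brack L x (brack L y z) = brack L (brack L x y) z - brack L (brack L x z) y)"

definition leibniz_hom ::
  "('k, 'v::ab_group_add) alg \<Rightarrow> ('k, 'w::ab_group_add) alg \<Rightarrow> ('v \<Rightarrow> 'w) \<Rightarrow> bool" where
  "leibniz_hom L M h \<longleftrightarrow>
     linear_map L M h \<and>
     (\<forall>x\<in>carr L. \<forall>y\<in>carr L. h (brack L x y) = brack M (h x) (h y))"

definition leibniz_iso ::
  "('k, 'v::ab_group_add) alg \<Rightarrow> ('k, 'w::ab_group_add) alg \<Rightarrow> ('v \<Rightarrow> 'w) \<Rightarrow> bool" where
  "leibniz_iso L M h \<longleftrightarrow> leibniz_hom L M h \<and> bij_betw h (carr L) (carr M)"


text \<open>
  The components of a datum of \<open>L\<close> by \<open>G\<close> are, in this order, \<open>\<triangleleft> : G \<times> L \<rightarrow> G\<close>,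
  \<open>\<triangleright> : L \<times> G \<rightarrow> G\<close>, \<open>f : L \<times> L \<rightarrow> G\<close> and the bracket on \<open>G\<close>.
\<close>

record ('l, 'g) datum =
  ract :: "'g \<Rightarrow> 'l \<Rightarrow> 'g"
  lact :: "'l \<Rightarrow> 'g \<Rightarrow> 'g"
  cocyc :: "'l \<Rightarrow> 'l \<Rightarrow> 'g"
  gbrack :: "'g \<Rightarrow> 'g \<Rightarrow> 'g"

definition pre_crossed_datum ::
  "('k::field, 'l::ab_group_add) alg \<Rightarrow> ('k, 'g::ab_group_add, 'm) vect_scheme
    \<Rightarrow> ('l, 'g) datum \<Rightarrow> bool" where
  "pre_crossed_datum L G \<Lambda> \<longleftrightarrow>
     bilinear_map G L G (ract \<Lambda>) \<and>
     bilinear_map L G G (lact \<Lambda>) \<and>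
     bilinear_map L L G (cocyc \<Lambda>) \<and>
     bilinear_map G G G (gbrack \<Lambda>)"

definition crossed_product ::
  "('k::field, 'l::ab_group_add) alg \<Rightarrow> ('k, 'g::ab_group_add, 'm) vect_scheme
    \<Rightarrow> ('l, 'g) datum \<Rightarrow> ('k, 'g \<times> 'l) alg" where
  "crossed_product L G \<Lambda> =
     with_bracket (prod_space G L)
       (\<lambda>(g, x) (h, y).
          (gbrack \<Lambda> g h + lact \<Lambda> x h + ract \<Lambda> g y + cocyc \<Lambda> x y, brack L x y))"

definition crossed_system ::
  "('k::field, 'l::ab_group_add) alg \<Rightarrow> ('k, 'g::ab_group_add, 'm) vect_scheme
    \<Rightarrow> ('l, 'g) datum \<Rightarrow> bool" where
  "crossed_system L G \<Lambda> \<longleftrightarrow>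
     leibniz_algebra L \<and> vector_space_on G \<and>
     pre_crossed_datum L G \<Lambda> \<and> leibniz_algebra (crossed_product L G \<Lambda>)"

definition cross_incl :: "'g \<Rightarrow> 'g \<times> 'l::zero" where
  "cross_incl g = (g, 0)"

definition cross_proj :: "'g \<times> 'l \<Rightarrow> 'l" where
  "cross_proj z = snd z"


text \<open>Exactness of \<open>0 \<rightarrow> G \<rightarrow> E \<rightarrow> L \<rightarrow> 0\<close> with maps \<open>i\<close> and \<open>p\<close>.\<close>

definition leibniz_extension ::
  "('k::field, 'g::ab_group_add) alg \<Rightarrow> ('k, 'e::ab_group_add) alg
    \<Rightarrow> ('k, 'l::ab_group_add) alg \<Rightarrow> ('g \<Rightarrow> 'e) \<Rightarrow> ('e \<Rightarrow> 'l) \<Rightarrow> bool" where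
  "leibniz_extension G E L i p \<longleftrightarrow>
     leibniz_algebra G \<and> leibniz_algebra E \<and> leibniz_algebra L \<and>
     leibniz_hom G E i \<and> leibniz_hom E L p \<and>
     inj_on i (carr G) \<and> i ` carr G = carr (kernel_space E p) \<and> p ` carr E = carr L"

definition cohomologous ::
  "('k::field, 'g::ab_group_add) alg \<Rightarrow> ('k, 'l::ab_group_add) alg
    \<Rightarrow> ('k, 'a::ab_group_add) alg \<Rightarrow> ('g \<Rightarrow> 'a) \<Rightarrow> ('a \<Rightarrow> 'l)
    \<Rightarrow> ('k, 'b::ab_group_add) alg \<Rightarrow> ('g \<Rightarrow> 'b) \<Rightarrow> ('b \<Rightarrow> 'l) \<Rightarrow> bool" where
  "cohomologous G L A i p B i' p' \<longleftrightarrow>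
     leibniz_extension G A L i p \<and> leibniz_extension G B L i' p' \<and>
     (\<exists>\<phi>. leibniz_iso A B \<phi> \<and>
        (\<forall>g\<in>carr G. (\<phi> \<circ> i) g = i' g) \<and> (\<forall>z\<in>carr A. (p' \<circ> \<phi>) z = p z))"

end

theory Submission
  imports Defs
begin

text \<open>
  A linear section \<open>s\<close> of \<open>p : E \<rightarrow> L\<close> splits \<open>E\<close> as a vector space, \<open>\<phi> (g, x) = i g + s x\<close>. Pulling
  the bracket of \<open>E\<close> back along \<open>\<phi>\<close> gives the crossed product bracket, whose components are
  \<open>g \<triangleleft> x = [g, s x]\<close>, \<open>x \<triangleright> g = [s x, g]\<close> and \<open>f (x, y) = [s x, s y] - s [x, y]\<close>, which lie in the
  kernel of \<open>p\<close>. The Leibniz law is inherited along the injective map \<open>\<phi>\<close>, so the crossed system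
  axioms need not be checked one by one.
\<close>

section \<open>Linear and bilinear maps between carriers\<close>

lemma vector_space_onD:
  assumes "vector_space_on V"
  shows vector_space_on_space: "vector_space (smult V)"
    and vector_space_on_zero: "0 \<in> carr V"
    and vector_space_on_add: "\<And>x y. x \<in> carr V \<Longrightarrow> y \<in> carr V \<Longrightarrow> x + y \<in> carr V"
    and vector_space_on_diff: "\<And>x y. x \<in> carr V \<Longrightarrow> y \<in> carr V \<Longrightarrow> x - y \<in> carr V"
    and vector_space_on_smult: "\<And>c x. x \<in> carr V \<Longrightarrow> smult V c x \<in> carr V"
proof -
  from assms interpret vector_space "smult V" by (simp add: vector_space_on_def)
  have sub: "subspace (carr V)" using assms by (simp add: vector_space_on_def)
  show "vector_space (smult V)" by unfold_locales
  show "0 \<in> carr V" using sub by (rule subspace_0)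
  show "\<And>x y. x \<in> carr V \<Longrightarrow> y \<in> carr V \<Longrightarrow> x + y \<in> carr V" using sub by (rule subspace_add)
  show "\<And>x y. x \<in> carr V \<Longrightarrow> y \<in> carr V \<Longrightarrow> x - y \<in> carr V" using sub by (rule subspace_diff)
  show "\<And>c x. x \<in> carr V \<Longrightarrow> smult V c x \<in> carr V" using sub by (rule subspace_scale)
qed

lemma linear_mapD:
  assumes "linear_map V W h"
  shows linear_map_in: "\<And>x. x \<in> carr V \<Longrightarrow> h x \<in> carr W"
    and linear_map_add: "\<And>x y. x \<in> carr V \<Longrightarrow> y \<in> carr V \<Longrightarrow> h (x + y) = h x + h y"
    and linear_map_smult: "\<And>c x. x \<in> carr V \<Longrightarrow> h (smult V c x) = smult W c (h x)"
  using assms by (auto simp: linear_map_def)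

lemma linear_map_zero:
  assumes "vector_space_on V" "linear_map V W h"
  shows "h 0 = 0"
  using linear_map_add[OF assms(2), of 0 0] vector_space_on_zero[OF assms(1)] by simp

lemma linear_map_diff:
  assumes "vector_space_on V" "linear_map V W h" "x \<in> carr V" "y \<in> carr V"
  shows "h (x - y) = h x - h y"
  using linear_map_add[OF assms(2), of "x - y" y] vector_space_on_diff[OF assms(1)] assms(3,4)
  by (simp add: algebra_simps)

lemma linear_map_minus:
  assumes W: "vector_space_on W" and f: "linear_map V W f" and g: "linear_map V W g"
  shows "linear_map V W (\<lambda>x. f x - g x)"
proof -
  interpret vector_space "smult W" using W by (rule vector_space_on_space)
  show ?thesis
    unfolding linear_map_def
    using linear_mapD[OF f] linear_mapD[OF g] vector_space_on_diff[OF W]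
    by (auto simp: scale_right_diff_distrib)
qed

lemma linear_map_compose:
  assumes "linear_map U V f" "linear_map V W g"
  shows "linear_map U W (\<lambda>x. g (f x))"
  using assms by (simp add: linear_map_def)

text \<open>Since \<open>i\<close> is linear and injective on \<open>carr G\<close>, both sides of a
  linearity equation for \<open>h\<close> may be compared after applying \<open>i\<close>, where the
  equation is linearity of \<open>k\<close>. This serves maps such as \<open>h\<close> that are
  given by choosing preimages, whose linearity is not visible from their definition.\<close>

lemma linear_map_cancel:
  assumes G: "vector_space_on G" and V: "vector_space_on V"
    and i: "linear_map G E i" "inj_on i (carr G)"
    and h: "\<And>x. x \<in> carr V \<Longrightarrow> h x \<in> carr G"
    and k: "linear_map V E k" "\<And>x. x \<in> carr V \<Longrightarrow> i (h x) = k x"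
  shows "linear_map V G h"
  unfolding linear_map_def
proof (intro conjI ballI allI)
  fix x y c assume x: "x \<in> carr V"
  show "h x \<in> carr G" by (rule h[OF x])
  have cx: "smult V c x \<in> carr V" by (rule vector_space_on_smult[OF V x])
  show "h (smult V c x) = smult G c (h x)"
    by (rule inj_onD[OF i(2)])
      (simp_all add: x cx h k(2) linear_map_smult[OF k(1)] linear_map_smult[OF i(1)]
        vector_space_on_smult[OF G])
  assume y: "y \<in> carr V"
  have xy: "x + y \<in> carr V" by (rule vector_space_on_add[OF V x y])
  show "h (x + y) = h x + h y"
    by (rule inj_onD[OF i(2)])
      (simp_all add: x y xy h k(2) linear_map_add[OF k(1)] linear_map_add[OF i(1)]
        vector_space_on_add[OF G])
qed

text \<open>Fixing either argument reduces this to cancellation of an injective linear map in one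
  variable. It yields bilinearity of the components of the datum from bilinearity of expressions in
  the bracket of the middle term.\<close>

lemma bilinear_map_cancel:
  assumes G: "vector_space_on G" and U: "vector_space_on U" and V: "vector_space_on V"
    and i: "linear_map G E i" "inj_on i (carr G)"
    and b: "\<And>u v. u \<in> carr U \<Longrightarrow> v \<in> carr V \<Longrightarrow> b u v \<in> carr G"
    and c: "bilinear_map U V E c"
      "\<And>u v. u \<in> carr U \<Longrightarrow> v \<in> carr V \<Longrightarrow> i (b u v) = c u v"
  shows "bilinear_map U V G b"
  unfolding bilinear_map_def
proof (intro conjI ballI)
  fix u assume u: "u \<in> carr U"
  have "linear_map V E (\<lambda>v. c u v)" using c(1) u by (simp add: bilinear_map_def)
  from linear_map_cancel[OF G V i b[OF u] this c(2)[OF u]]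
  show "linear_map V G (\<lambda>v. b u v)" .
next
  fix v assume v: "v \<in> carr V"
  have "linear_map U E (\<lambda>u. c u v)" using c(1) v by (simp add: bilinear_map_def)
  from linear_map_cancel[OF G U i b[OF _ v] this c(2)[OF _ v]]
  show "linear_map U G (\<lambda>u. b u v)" .
qed

lemma bilinear_map_compose:
  assumes "linear_map U U' f" "linear_map V V' g" "bilinear_map U' V' W b"
  shows "bilinear_map U V W (\<lambda>u v. b (f u) (g v))"
  unfolding bilinear_map_def
proof (intro conjI ballI)
  fix u assume "u \<in> carr U"
  then have "linear_map V' W (\<lambda>v. b (f u) v)"
    using assms(3) linear_map_in[OF assms(1)] by (simp add: bilinear_map_def)
  with assms(2) show "linear_map V W (\<lambda>v. b (f u) (g v))" by (rule linear_map_compose)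
next
  fix v assume "v \<in> carr V"
  then have "linear_map U' W (\<lambda>u. b u (g v))"
    using assms(3) linear_map_in[OF assms(2)] by (simp add: bilinear_map_def)
  with assms(1) show "linear_map U W (\<lambda>u. b (f u) (g v))" by (rule linear_map_compose)
qed

lemma linear_map_ident: "linear_map V V (\<lambda>x. x)"
  by (simp add: linear_map_def)

section \<open>Leibniz algebras and transport of their laws\<close>

lemma leibniz_algebraD:
  assumes "leibniz_algebra L"
  shows leibniz_algebra_space: "vector_space_on L"
    and leibniz_algebra_bilinear: "bilinear_map L L L (brack L)"
    and leibniz_algebra_brack_in:
      "\<And>x y. x \<in> carr L \<Longrightarrow> y \<in> carr L \<Longrightarrow> brack L x y \<in> carr L"
    and leibniz_algebra_brack_add_right: "\<And>x y z. x \<in> carr L \<Longrightarrow> y \<in> carr L \<Longrightarrow> z \<in> carr L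
      \<Longrightarrow> brack L x (y + z) = brack L x y + brack L x z"
    and leibniz_algebra_brack_add_left: "\<And>x y z. x \<in> carr L \<Longrightarrow> y \<in> carr L \<Longrightarrow> z \<in> carr L
      \<Longrightarrow> brack L (x + y) z = brack L x z + brack L y z"
    and leibniz_algebra_brack_zero:
      "\<And>x. x \<in> carr L \<Longrightarrow> brack L x 0 = 0" "\<And>x. x \<in> carr L \<Longrightarrow> brack L 0 x = 0"
    and leibniz_algebra_leibniz: "\<And>x y z. x \<in> carr L \<Longrightarrow> y \<in> carr L \<Longrightarrow> z \<in> carr L
      \<Longrightarrow> brack L x (brack L y z) = brack L (brack L x y) z - brack L (brack L x z) y"
proof -
  show V: "vector_space_on L" and B: "bilinear_map L L L (brack L)"
    using assms by (simp_all add: leibniz_algebra_def)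
  show "\<And>x y z. x \<in> carr L \<Longrightarrow> y \<in> carr L \<Longrightarrow> z \<in> carr L
      \<Longrightarrow> brack L x (brack L y z) = brack L (brack L x y) z - brack L (brack L x z) y"
    using assms by (simp add: leibniz_algebra_def)
  have l: "linear_map L L (\<lambda>y. brack L x y)" and r: "linear_map L L (\<lambda>y. brack L y x)"
    if "x \<in> carr L" for x
    using B that by (simp_all add: bilinear_map_def)
  show "\<And>x y. x \<in> carr L \<Longrightarrow> y \<in> carr L \<Longrightarrow> brack L x y \<in> carr L"
    using l linear_map_in by blast
  show "\<And>x y z. x \<in> carr L \<Longrightarrow> y \<in> carr L \<Longrightarrow> z \<in> carr L
      \<Longrightarrow> brack L x (y + z) = brack L x y + brack L x z"
    using linear_map_add[OF l] by blast
  show "\<And>x y z. x \<in> carr L \<Longrightarrow> y \<in> carr L \<Longrightarrow> z \<in> carr L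
      \<Longrightarrow> brack L (x + y) z = brack L x z + brack L y z"
    using linear_map_add[OF r] by blast
  show "\<And>x. x \<in> carr L \<Longrightarrow> brack L x 0 = 0" "\<And>x. x \<in> carr L \<Longrightarrow> brack L 0 x = 0"
    using linear_map_zero[OF V l] linear_map_zero[OF V r] by blast+
qed

text \<open>Applying the injective map \<open>h\<close> turns bilinearity and the Leibniz law of
  \<open>A\<close> into those of \<open>E\<close>. Only closure of \<open>carr A\<close> under the
  bracket has to be supplied. It is applied to the crossed product, with \<open>h\<close> the
  splitting map, and to the kernel, with \<open>h\<close> the inclusion.\<close>

lemma leibniz_algebra_inj:
  assumes A: "vector_space_on A" and E: "leibniz_algebra E"
    and h: "linear_map A E h" "inj_on h (carr A)"
    and in_A: "\<And>x y. x \<in> carr A \<Longrightarrow> y \<in> carr A \<Longrightarrow> brack A x y \<in> carr A"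
    and hb: "\<And>x y. x \<in> carr A \<Longrightarrow> y \<in> carr A \<Longrightarrow> h (brack A x y) = brack E (h x) (h y)"
  shows "leibniz_algebra A"
  unfolding leibniz_algebra_def
proof (intro conjI ballI)
  show "vector_space_on A" by (rule A)
  show "bilinear_map A A A (brack A)"
    by (rule bilinear_map_cancel[OF A A A h in_A
          bilinear_map_compose[OF h(1) h(1) leibniz_algebra_bilinear[OF E]] hb])
next
  fix x y z assume *: "x \<in> carr A" "y \<in> carr A" "z \<in> carr A"
  note hin = linear_map_in[OF h(1)]
  show "brack A x (brack A y z) = brack A (brack A x y) z - brack A (brack A x z) y"
    by (rule inj_onD[OF h(2)])
      (simp_all add: * in_A hb vector_space_on_diff[OF A] linear_map_diff[OF A h(1)]
        leibniz_algebra_leibniz[OF E] hin)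
qed

section \<open>Products, kernels and linear sections\<close>

lemma vector_space_on_prod_space:
  assumes V: "vector_space_on V" and W: "vector_space_on W"
  shows "vector_space_on (prod_space V W)"
    and "smult (prod_space V W) = (\<lambda>c (v, w). (smult V c v, smult W c w))"
proof -
  interpret V: vector_space "smult V" using V by (rule vector_space_on_space)
  interpret W: vector_space "smult W" using W by (rule vector_space_on_space)
  interpret P: vector_space_prod "smult V" "smult W" ..
  show s: "smult (prod_space V W) = (\<lambda>c (v, w). (smult V c v, smult W c w))"
    by (simp add: prod_space_def P.scale_def fun_eq_iff split_beta)
  have "vector_space P.scale" ..
  then show "vector_space_on (prod_space V W)"
    unfolding vector_space_on_def
    using vector_space_onD[OF V] vector_space_onD[OF W]
    by (auto simp: prod_space_def P.p.subspace_def P.scale_def zero_prod_def)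
qed

lemma vector_space_on_kernel_space:
  assumes E: "vector_space_on E" and p: "linear_map E L p" and L: "vector_space_on L"
  shows "vector_space_on (kernel_space E p)"
proof -
  interpret E: vector_space "smult E" using E by (rule vector_space_on_space)
  interpret L: vector_space "smult L" using L by (rule vector_space_on_space)
  show ?thesis
    unfolding vector_space_on_def
    using vector_space_onD[OF E] linear_mapD[OF p] linear_map_zero[OF E p]
    by (auto simp: kernel_space_def E.subspace_def E.vector_space_axioms)
qed

text \<open>A choice of preimages on a basis of \<open>carr L\<close> extends linearly. Composing
  the extension with \<open>p\<close> fixes every basis vector, hence the whole span.\<close>

lemma linear_section_exists:
  assumes E: "vector_space_on E" and L: "vector_space_on L"
    and p: "linear_map E L p" "p ` carr E = carr L"
  obtains s where "linear_map L E s" "\<And>x. x \<in> carr L \<Longrightarrow> p (s x) = x"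
proof -
  interpret vector_space_pair "smult L" "smult E"
    using vector_space_on_space[OF E] vector_space_on_space[OF L]
    by (simp add: vector_space_pair_def)
  have subL: "vs1.subspace (carr L)" and subE: "vs2.subspace (carr E)"
    using E L by (simp_all add: vector_space_on_def)
  obtain B where B: "B \<subseteq> carr L" "vs1.independent B" "carr L \<subseteq> vs1.span B"
    using vs1.basis_exists by metis
  \<comment> \<open>\<open>t\<close> is a section of sets and need not be linear; \<open>s\<close>
    agrees with it on \<open>B\<close> only and is linear on the whole ambient type.\<close>
  define t where "t = inv_into (carr E) p"
  define s where "s = construct B t"
  have t: "t x \<in> carr E" "p (t x) = x" if "x \<in> carr L" for x
    using that unfolding t_def p(2)[symmetric] by (simp_all add: inv_into_into f_inv_into_f)
  have lin: "Vector_Spaces.linear (smult L) (smult E) s"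
    unfolding s_def by (rule linear_construct[OF B(2)])
  \<comment> \<open>This covers every \<open>x\<close> of the ambient type, so the span induction
    below can use linearity of \<open>p\<close> on values of \<open>s\<close> without tracking
    membership in \<open>carr L\<close>.\<close>
  have in_E: "s x \<in> carr E" for x
  proof -
    have "s x \<in> vs2.span (t ` B)" unfolding s_def by (rule construct_in_span[OF B(2)])
    also have "\<dots> \<subseteq> carr E" using t(1) B(1) by (intro vs2.span_minimal subE) auto
    finally show ?thesis .
  qed
  have "p (s x) = x" if "x \<in> carr L" for x
  proof -
    have "x \<in> vs1.span B" using B(3) that by blast
    then show ?thesis
    proof (induction rule: vs1.span_induct_alt)
      case base
      show ?case using linear_0[OF lin] linear_map_zero[OF E p(1)] by simp
    next
      case (step c b y)
      have "s b = t b" unfolding s_def by (rule construct_basis[OF B(2) step(1)])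
      then have "p (s b) = b" using t(2) step(1) B(1) by auto
      with step(2) show ?case
        by (simp add: linear_add[OF lin] linear_scale[OF lin] linear_map_add[OF p(1)]
            linear_map_smult[OF p(1)] in_E vector_space_on_smult[OF E])
    qed
  qed
  moreover have "linear_map L E s"
    unfolding linear_map_def
    by (simp add: in_E linear_add[OF lin] linear_scale[OF lin])
  ultimately show ?thesis using that by blast
qed

section \<open>The crossed product attached to an extension\<close>

lemma carr_crossed_product [simp]: "carr (crossed_product L G \<Lambda>) = carr G \<times> carr L"
  by (simp add: crossed_product_def with_bracket_def prod_space_def)

lemma brack_crossed_product [simp]: "brack (crossed_product L G \<Lambda>) (g, x) (h, y) =
    (gbrack \<Lambda> g h + lact \<Lambda> x h + ract \<Lambda> g y + cocyc \<Lambda> x y, brack L x y)"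
  by (simp add: crossed_product_def with_bracket_def)

lemma
  assumes "vector_space_on G" "vector_space_on L"
  shows vector_space_on_crossed_product: "vector_space_on (crossed_product L G \<Lambda>)"
    and smult_crossed_product:
      "smult (crossed_product L G \<Lambda>) = (\<lambda>c (g, x). (smult G c g, smult L c x))"
  using vector_space_on_prod_space[OF assms]
  by (simp_all add: vector_space_on_def crossed_product_def with_bracket_def)

text \<open>Stated for an arbitrary injection \<open>i\<close> instead of an inclusion, so that it
  serves both halves of the theorem: in the first one \<open>i\<close> is the identity on the kernel
  of the given projection.\<close>

lemma leibniz_extension_crossed_product_iso:
  fixes G :: "('k::field, 'g::ab_group_add) alg" and E :: "('k, 'e::ab_group_add) alg"
    and L :: "('k, 'l::ab_group_add) alg"
  assumes ext: "leibniz_extension G E L i p"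
  obtains \<Lambda> \<phi> where "crossed_system L G \<Lambda>"
    "leibniz_extension G (crossed_product L G \<Lambda>) L cross_incl cross_proj"
    "leibniz_iso (crossed_product L G \<Lambda>) E \<phi>"
    "\<And>g. g \<in> carr G \<Longrightarrow> \<phi> (cross_incl g) = i g"
    "\<And>z. z \<in> carr (crossed_product L G \<Lambda>) \<Longrightarrow> p (\<phi> z) = cross_proj z"
proof -
  have algs: "leibniz_algebra G" "leibniz_algebra E" "leibniz_algebra L"
    and i: "linear_map G E i" "inj_on i (carr G)" "i ` carr G = {z \<in> carr E. p z = 0}"
    and ib: "\<And>g h. g \<in> carr G \<Longrightarrow> h \<in> carr G \<Longrightarrow> i (brack G g h) = brack E (i g) (i h)"
    and p: "linear_map E L p" "p ` carr E = carr L"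
    and pb: "\<And>a b. a \<in> carr E \<Longrightarrow> b \<in> carr E \<Longrightarrow> p (brack E a b) = brack L (p a) (p b)"
    using ext by (auto simp: leibniz_extension_def leibniz_hom_def kernel_space_def)
  note G = leibniz_algebraD[OF algs(1)] and E = leibniz_algebraD[OF algs(2)]
    and L = leibniz_algebraD[OF algs(3)]
  note Gv = vector_space_onD[OF G(1)] and Ev = vector_space_onD[OF E(1)]
    and Lv = vector_space_onD[OF L(1)]
  obtain s where s: "linear_map L E s" and ps: "\<And>x. x \<in> carr L \<Longrightarrow> p (s x) = x"
    using linear_section_exists[OF E(1) L(1) p] by blast
  note i_in = linear_map_in[OF i(1)] and s_in = linear_map_in[OF s] and p_in = linear_map_in[OF p(1)]
  have pi: "p (i g) = 0" if "g \<in> carr G" for g using i(3) that by blast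
  \<comment> \<open>\<open>j\<close> inverts \<open>i\<close> on the kernel of \<open>p\<close>,
    which is the image of \<open>i\<close> by exactness. Its values elsewhere are arbitrary and
    never enter.\<close>
  define j where "j = inv_into (carr G) i"
  have j: "j a \<in> carr G" "i (j a) = a" if "a \<in> carr E" "p a = 0" for a
  proof -
    have "a \<in> i ` carr G" using that i(3) by simp
    then show "j a \<in> carr G" "i (j a) = a"
      unfolding j_def by (simp_all add: inv_into_into f_inv_into_f)
  qed
  \<comment> \<open>Here \<open>j\<close> carries kernel elements of \<open>E\<close> back to
    \<open>G\<close>. The last component is the given bracket of \<open>G\<close>, which agrees with
    that of \<open>E\<close> because \<open>i\<close> is a homomorphism.\<close>
  define \<Lambda> where "\<Lambda> = \<lparr>ract = (\<lambda>g x. j (brack E (i g) (s x))),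
    lact = (\<lambda>x g. j (brack E (s x) (i g))),
    cocyc = (\<lambda>x y. j (brack E (s x) (s y) - s (brack L x y))), gbrack = brack G\<rparr>"
  \<comment> \<open>\<open>j\<close> may be applied because \<open>p\<close> sends these brackets to
    brackets in \<open>L\<close> with one argument \<open>p (i g) = 0\<close>.\<close>
  have ract: "ract \<Lambda> g x \<in> carr G" "i (ract \<Lambda> g x) = brack E (i g) (s x)"
    and lact: "lact \<Lambda> x g \<in> carr G" "i (lact \<Lambda> x g) = brack E (s x) (i g)"
    if "g \<in> carr G" "x \<in> carr L" for g x
    using that unfolding \<Lambda>_def
    by (auto intro!: j simp: E i_in s_in p_in pi ps pb L)
  \<comment> \<open>Both terms of the difference are sent by \<open>p\<close> to
    \<open>brack L x y\<close>, so the difference lies in the kernel.\<close>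
  have cocyc: "cocyc \<Lambda> x y \<in> carr G"
    "i (cocyc \<Lambda> x y) = brack E (s x) (s y) - s (brack L x y)"
    if "x \<in> carr L" "y \<in> carr L" for x y
    using that unfolding \<Lambda>_def
    by (auto intro!: j simp: E Ev i_in s_in p_in ps pb L linear_map_diff[OF E(1) p(1)])
  have gbrack: "gbrack \<Lambda> = brack G" by (simp add: \<Lambda>_def)
  have pre: "pre_crossed_datum L G \<Lambda>"
    unfolding pre_crossed_datum_def
  proof (intro conjI)
    show "bilinear_map G L G (ract \<Lambda>)"
      by (rule bilinear_map_cancel[OF G(1) G(1) L(1) i(1,2) ract(1)
            bilinear_map_compose[OF i(1) s E(2)] ract(2)])
    show "bilinear_map L G G (lact \<Lambda>)"
      by (rule bilinear_map_cancel[OF G(1) L(1) G(1) i(1,2) lact(1)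
            bilinear_map_compose[OF s i(1) E(2)] lact(2)])
    \<comment> \<open>For the cocycle the comparison map in \<open>E\<close> is a difference; its
      second term is linear in each variable as a composite of the bracket of \<open>L\<close> with
      \<open>s\<close>.\<close>
    have "linear_map L E (\<lambda>y. s (brack L x y))" "linear_map L E (\<lambda>y. s (brack L y x))"
      if "x \<in> carr L" for x
      using linear_map_compose[OF _ s] L(2) that by (auto simp: bilinear_map_def)
    then have cb: "bilinear_map L L E (\<lambda>x y. brack E (s x) (s y) - s (brack L x y))"
      using bilinear_map_compose[OF s s E(2)]
      by (auto simp: bilinear_map_def intro!: linear_map_minus[OF E(1)])
    show "bilinear_map L L G (cocyc \<Lambda>)"
      by (rule bilinear_map_cancel[OF G(1) L(1) L(1) i(1,2) cocyc(1) cb cocyc(2)])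
    show "bilinear_map G G G (gbrack \<Lambda>)" using G(2) by (simp add: gbrack)
  qed
  let ?C = "crossed_product L G \<Lambda>"
  note C = vector_space_on_crossed_product[OF G(1) L(1), of \<Lambda>]
    and smult_C = smult_crossed_product[OF G(1) L(1), of \<Lambda>]
  define \<phi> where "\<phi> = (\<lambda>(g, x). i g + s x)"
  have p\<phi>: "p (\<phi> z) = snd z" if "z \<in> carr ?C" for z
    using that by (auto simp: \<phi>_def linear_map_add[OF p(1)] i_in s_in pi ps)
  have \<phi>_lin: "linear_map ?C E \<phi>"
  proof -
    interpret vector_space "smult E" by (rule Ev(1))
    show ?thesis
      using linear_mapD[OF i(1)] linear_mapD[OF s] Ev
      by (auto simp: linear_map_def \<phi>_def smult_C scale_right_distrib)
  qed
  have \<phi>_inj: "inj_on \<phi> (carr ?C)"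
  proof (rule inj_onI)
    fix z w assume z: "z \<in> carr ?C" and w: "w \<in> carr ?C" and eq: "\<phi> z = \<phi> w"
    \<comment> \<open>Applying \<open>p\<close> recovers the second component. The terms in
      \<open>s\<close> then cancel and injectivity of \<open>i\<close> settles the first
      component.\<close>
    have "snd z = snd w" using p\<phi>[OF z] p\<phi>[OF w] eq by simp
    moreover from this have "i (fst z) = i (fst w)" using eq by (simp add: \<phi>_def split_beta)
    then have "fst z = fst w" using inj_onD[OF i(2)] z w by auto
    ultimately show "z = w" by (simp add: prod_eq_iff)
  qed
  have \<phi>_surj: "\<phi> ` carr ?C = carr E"
  proof
    show "\<phi> ` carr ?C \<subseteq> carr E" using linear_map_in[OF \<phi>_lin] by blast
    show "carr E \<subseteq> \<phi> ` carr ?C"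
    proof
      fix a assume a: "a \<in> carr E"
      \<comment> \<open>The preimage of \<open>a\<close> comes from the decomposition
        \<open>a = (a - s (p a)) + s (p a)\<close>, whose first summand is killed by
        \<open>p\<close> because \<open>p (s (p a)) = p a\<close>.\<close>
      have "j (a - s (p a)) \<in> carr G" "i (j (a - s (p a))) = a - s (p a)"
        by (rule j; simp add: a Ev s_in p_in linear_map_diff[OF E(1) p(1)] ps)+
      then have "(j (a - s (p a)), p a) \<in> carr ?C" "\<phi> (j (a - s (p a)), p a) = a"
        using p_in[OF a] by (simp_all add: \<phi>_def)
      then show "a \<in> \<phi> ` carr ?C" by (metis imageI)
    qed
  qed
  have C_in: "brack ?C z w \<in> carr ?C" if "z \<in> carr ?C" "w \<in> carr ?C" for z w
    using that by (auto simp: gbrack G(3) L(3) ract lact cocyc Gv)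
  \<comment> \<open>The term \<open>- s (brack L x y)\<close> from the cocycle cancels against
    \<open>s\<close> of the second component. What remains are the four terms of
    \<open>brack E (i g + s x) (i h + s y)\<close>.\<close>
  have \<phi>_brack: "\<phi> (brack ?C z w) = brack E (\<phi> z) (\<phi> w)"
    if "z \<in> carr ?C" "w \<in> carr ?C" for z w
    using that
    by (auto simp: \<phi>_def gbrack G(3) L(3) ract lact cocyc Gv linear_map_add[OF i(1)]
        ib E(3-5) Ev i_in s_in)
  have C_alg: "leibniz_algebra ?C"
    by (rule leibniz_algebra_inj[OF C algs(2) \<phi>_lin \<phi>_inj C_in \<phi>_brack])
  show ?thesis
  proof
    show "crossed_system L G \<Lambda>"
      using algs(3) G(1) pre C_alg by (simp add: crossed_system_def)
    show "leibniz_iso ?C E \<phi>"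
      using \<phi>_lin \<phi>_inj \<phi>_surj \<phi>_brack by (simp add: leibniz_iso_def leibniz_hom_def bij_betw_def)
    show "p (\<phi> z) = cross_proj z" if "z \<in> carr ?C" for z
      using p\<phi>[OF that] by (simp add: cross_proj_def)
    show incl: "\<phi> (cross_incl g) = i g" for g
      by (simp add: \<phi>_def cross_incl_def linear_map_zero[OF L(1) s])
    have incl_in: "cross_incl g \<in> carr ?C" if "g \<in> carr G" for g
      using that Lv by (simp add: cross_incl_def)
    \<comment> \<open>Both parts are compared after the injective map \<open>\<phi>\<close>, which
      turns \<open>cross_incl\<close> into the homomorphism \<open>i\<close>.\<close>
    have "leibniz_hom G ?C cross_incl"
      unfolding leibniz_hom_def
    proof (intro conjI ballI)
      show "linear_map G ?C cross_incl"
        by (rule linear_map_cancel[OF C G(1) \<phi>_lin \<phi>_inj incl_in i(1) incl])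
      fix g h assume gh: "g \<in> carr G" "h \<in> carr G"
      show "cross_incl (brack G g h) = brack ?C (cross_incl g) (cross_incl h)"
        \<comment> \<open>The carrier of the crossed product stays folded so that
          \<open>incl_in\<close> matches the premises of \<open>C_in\<close> and
          \<open>\<phi>_brack\<close>.\<close>
        by (rule inj_onD[OF \<phi>_inj])
          (simp_all add: gh incl incl_in C_in \<phi>_brack ib G(3) del: carr_crossed_product)
    qed
    moreover have "leibniz_hom ?C L cross_proj"
      unfolding leibniz_hom_def linear_map_def
      by (auto simp: cross_proj_def smult_C)
    moreover have "inj_on cross_incl (carr G)" by (simp add: inj_on_def cross_incl_def)
    moreover have "cross_incl ` carr G = carr (kernel_space ?C cross_proj)"
      using Lv by (auto simp: cross_incl_def kernel_space_def cross_proj_def)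
    moreover have "cross_proj ` carr ?C = carr L"
      using Gv(2) by (force simp: cross_proj_def)
    ultimately show "leibniz_extension G ?C L cross_incl cross_proj"
      using algs C_alg by (simp add: leibniz_extension_def)
  qed
qed

section \<open>Inverse isomorphisms and the kernel extension\<close>

text \<open>Needed to change direction: the construction maps the crossed product to
  \<open>E\<close>, whereas the second half of the theorem asks for a map from \<open>E\<close> to
  the crossed product.\<close>

lemma leibniz_iso_inv_into:
  assumes A: "leibniz_algebra A" and \<phi>: "leibniz_iso A B \<phi>" and B: "leibniz_algebra B"
  shows "leibniz_iso B A (inv_into (carr A) \<phi>)"
proof -
  let ?\<psi> = "inv_into (carr A) \<phi>"
  have lin: "linear_map A B \<phi>" and bij: "bij_betw \<phi> (carr A) (carr B)"
    and br: "\<And>x y. x \<in> carr A \<Longrightarrow> y \<in> carr A \<Longrightarrow> \<phi> (brack A x y) = brack B (\<phi> x) (\<phi> y)"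
    using \<phi> by (auto simp: leibniz_iso_def leibniz_hom_def)
  have inj: "inj_on \<phi> (carr A)" using bij by (simp add: bij_betw_def)
  have bij': "bij_betw ?\<psi> (carr B) (carr A)" using bij by (rule bij_betw_inv_into)
  have inv: "\<phi> (?\<psi> b) = b" if "b \<in> carr B" for b
    using bij that by (rule bij_betw_inv_into_right)
  have inA: "?\<psi> b \<in> carr A" if "b \<in> carr B" for b using bij' that by (rule bij_betwE[rule_format])
  \<comment> \<open>Cancelling \<open>\<phi>\<close> compares \<open>?\<psi>\<close> with the
    identity of \<open>B\<close>, which is linear.\<close>
  have "linear_map B A ?\<psi>"
    by (rule linear_map_cancel[OF leibniz_algebra_space[OF A] leibniz_algebra_space[OF B]
          lin inj inA linear_map_ident inv])
  moreover have "?\<psi> (brack B x y) = brack A (?\<psi> x) (?\<psi> y)" if "x \<in> carr B" "y \<in> carr B" for x y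
    by (rule inj_onD[OF inj])
      (simp_all add: that inA inv br leibniz_algebra_brack_in[OF A] leibniz_algebra_brack_in[OF B])
  ultimately show ?thesis using bij' by (simp add: leibniz_iso_def leibniz_hom_def)
qed

text \<open>The kernel is closed under the bracket since \<open>p\<close> sends a bracket of two
  kernel elements to \<open>brack L 0 0 = 0\<close>; the Leibniz law is then inherited along the
  inclusion. This presents the data of the first half of the theorem as an extension.\<close>

lemma leibniz_extension_kernel_space:
  assumes L: "leibniz_algebra L" and E: "leibniz_algebra (with_bracket E b)"
    and p: "leibniz_hom (with_bracket E b) L p" "p ` carr E = carr L"
  shows "leibniz_extension (with_bracket (kernel_space E p) b) (with_bracket E b) L (\<lambda>x. x) p"
proof -
  let ?E = "with_bracket E b" and ?K = "with_bracket (kernel_space E p) b"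
  have lin: "linear_map ?E L p"
    and pb: "\<And>x y. x \<in> carr ?E \<Longrightarrow> y \<in> carr ?E \<Longrightarrow> p (brack ?E x y) = brack L (p x) (p y)"
    using p(1) by (auto simp: leibniz_hom_def)
  have carr: "carr ?K = {x \<in> carr ?E. p x = 0}" and br: "brack ?K = brack ?E"
    and sm: "smult ?K = smult ?E"
    by (simp_all add: with_bracket_def kernel_space_def)
  have "vector_space_on ?K"
    using vector_space_on_kernel_space[OF leibniz_algebra_space[OF E] lin leibniz_algebra_space[OF L]]
    by (simp add: vector_space_on_def with_bracket_def kernel_space_def)
  moreover have incl: "linear_map ?K ?E (\<lambda>x. x)" by (simp add: linear_map_def carr sm)
  ultimately have "leibniz_algebra ?K"
    by (rule leibniz_algebra_inj[OF _ E])
      (simp_all add: carr br leibniz_algebra_brack_in[OF E] pb leibniz_algebra_brack_zero[OF L]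
        vector_space_on_zero[OF leibniz_algebra_space[OF L]])
  with L E p incl show ?thesis
    by (simp add: leibniz_extension_def leibniz_hom_def br carr)
      (simp add: kernel_space_def with_bracket_def)
qed

theorem theorem2p1:
  fixes L :: "('k::field, 'l::ab_group_add) alg"
  assumes "leibniz_algebra L"
  shows
    "(\<forall>(E :: ('k, 'e::ab_group_add) vect) (\<pi> :: 'e \<Rightarrow> 'l) (br\<^sub>E :: 'e \<Rightarrow> 'e \<Rightarrow> 'e).
        vector_space_on E \<and> linear_map E L \<pi> \<and> \<pi> ` carr E = carr L \<and>
        leibniz_algebra (with_bracket E br\<^sub>E) \<and> leibniz_hom (with_bracket E br\<^sub>E) L \<pi>
        \<longrightarrow>
        (\<exists>(\<Lambda> :: ('l, 'e) datum) \<phi>.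
           crossed_system L (kernel_space E \<pi>) \<Lambda> \<and>
           leibniz_iso (crossed_product L (kernel_space E \<pi>) \<Lambda>) (with_bracket E br\<^sub>E) \<phi> \<and>
           (\<forall>g\<in>carr (kernel_space E \<pi>). (\<phi> \<circ> cross_incl) g = g) \<and>
           (\<forall>z\<in>carr (crossed_product L (kernel_space E \<pi>) \<Lambda>). (\<pi> \<circ> \<phi>) z = cross_proj z)))
     \<and>
     (\<forall>(G :: ('k, 'g::ab_group_add) alg) (E :: ('k, 'a::ab_group_add) alg)
         (i :: 'g \<Rightarrow> 'a) (p :: 'a \<Rightarrow> 'l).
        leibniz_extension G E L i p
        \<longrightarrow>
        (\<exists>\<Lambda> :: ('l, 'g) datum.
           crossed_system L G \<Lambda> \<and>
           cohomologous G L E i p (crossed_product L G \<Lambda>) cross_incl cross_proj))"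
proof (intro conjI allI impI)
  fix E :: "('k, 'e) vect" and \<pi> :: "'e \<Rightarrow> 'l" and b :: "'e \<Rightarrow> 'e \<Rightarrow> 'e"
  assume H: "vector_space_on E \<and> linear_map E L \<pi> \<and> \<pi> ` carr E = carr L \<and>
    leibniz_algebra (with_bracket E b) \<and> leibniz_hom (with_bracket E b) L \<pi>"
  let ?K = "kernel_space E \<pi>"
  have "leibniz_extension (with_bracket ?K b) (with_bracket E b) L (\<lambda>x. x) \<pi>"
    using H assms by (intro leibniz_extension_kernel_space) auto
  then obtain \<Lambda> \<phi> where *: "crossed_system L (with_bracket ?K b) \<Lambda>"
    "leibniz_iso (crossed_product L (with_bracket ?K b) \<Lambda>) (with_bracket E b) \<phi>"
    "\<And>g. g \<in> carr (with_bracket ?K b) \<Longrightarrow> \<phi> (cross_incl g) = g"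
    "\<And>z. z \<in> carr (crossed_product L (with_bracket ?K b) \<Lambda>) \<Longrightarrow> \<pi> (\<phi> z) = cross_proj z"
    by (rule leibniz_extension_crossed_product_iso) blast
  \<comment> \<open>A crossed product reads only the carrier and the scalar multiplication of its
    second argument; the bracket comes from the datum. So the result for the kernel as an algebra
    carries over to the kernel as a bare vector space.\<close>
  have "crossed_product L (with_bracket ?K b) \<Lambda> = crossed_product L ?K \<Lambda>"
    by (simp add: crossed_product_def prod_space_def with_bracket_def)
  moreover have "carr (with_bracket ?K b) = carr ?K" "smult (with_bracket ?K b) = smult ?K"
    by (simp_all add: with_bracket_def)
  ultimately show "\<exists>(\<Lambda> :: ('l, 'e) datum) \<phi>. crossed_system L ?K \<Lambda> \<and>
      leibniz_iso (crossed_product L ?K \<Lambda>) (with_bracket E b) \<phi> \<and>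
      (\<forall>g\<in>carr ?K. (\<phi> \<circ> cross_incl) g = g) \<and>
      (\<forall>z\<in>carr (crossed_product L ?K \<Lambda>). (\<pi> \<circ> \<phi>) z = cross_proj z)"
    using * by (intro exI[of _ \<Lambda>] exI[of _ \<phi>])
      (simp add: crossed_system_def pre_crossed_datum_def bilinear_map_def linear_map_def
        vector_space_on_def)
next
  fix G :: "('k, 'g) alg" and E :: "('k, 'a) alg" and i :: "'g \<Rightarrow> 'a" and p :: "'a \<Rightarrow> 'l"
  assume ext: "leibniz_extension G E L i p"
  obtain \<Lambda> \<phi> where \<Lambda>: "crossed_system L G \<Lambda>"
    and ext': "leibniz_extension G (crossed_product L G \<Lambda>) L cross_incl cross_proj"
    and iso: "leibniz_iso (crossed_product L G \<Lambda>) E \<phi>"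
    and incl: "\<And>g. g \<in> carr G \<Longrightarrow> \<phi> (cross_incl g) = i g"
    and proj: "\<And>z. z \<in> carr (crossed_product L G \<Lambda>) \<Longrightarrow> p (\<phi> z) = cross_proj z"
    using ext by (rule leibniz_extension_crossed_product_iso) blast
  let ?C = "crossed_product L G \<Lambda>"
  let ?\<psi> = "inv_into (carr ?C) \<phi>"
  have bij: "bij_betw \<phi> (carr ?C) (carr E)" using iso by (simp add: leibniz_iso_def)
  have "leibniz_iso E ?C ?\<psi>"
    using ext ext' iso by (intro leibniz_iso_inv_into) (auto simp: leibniz_extension_def)
  moreover have "?\<psi> (i g) = cross_incl g" if g: "g \<in> carr G" for g
  proof -
    have "cross_incl g \<in> carr ?C"
      using ext' g by (simp only: leibniz_extension_def leibniz_hom_def linear_map_def)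
    then show ?thesis using bij_betw_inv_into_left[OF bij] incl[OF g] by metis
  qed
  \<comment> \<open>Co-stabilization of \<open>\<phi>\<close> is evaluated at
    \<open>?\<psi> a\<close>, where \<open>\<phi> (?\<psi> a) = a\<close>.\<close>
  moreover have "cross_proj (?\<psi> a) = p a" if a: "a \<in> carr E" for a
    using proj[of "?\<psi> a"] bij_betw_inv_into_right[OF bij a]
      bij_betwE[OF bij_betw_inv_into[OF bij]] a by metis
  ultimately have "cohomologous G L E i p ?C cross_incl cross_proj"
    unfolding cohomologous_def using ext ext' by (auto intro!: exI[of _ ?\<psi>])
  with \<Lambda> show "\<exists>\<Lambda> :: ('l, 'g) datum. crossed_system L G \<Lambda> \<and>
      cohomologous G L E i p (crossed_product L G \<Lambda>) cross_incl cross_proj"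
    by blast
qed

end
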